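(* Let $A=(\mathcal{A},w)$ be a constrained system with ordered set of distinct string weights $\Omega=\{\nu_k\}_{k=1}^\infty$, $\nu_1<\nu_2<\dotsb$, and for each $k$ let $N(\nu_k)$ be the number of distinct strings of weight $\nu_k$ in $\mathcal{A}$. Let $G_A(s)=\sum_{a\in\mathcal{A}}e^{-w(a)s}=\sum_{k=1}^\infty N(\nu_k)e^{-\nu_k s}$ be the generating function of $A$ and let $Q$ be its abscissa of convergence. Then: (1) The combinatorial capacity $\mathsf{C}$ of $A$ equals $Q$, i.e. $$\limsup_{k\to\infty}\frac{\ln\bigl[\sum_{l=1}^k N(\nu_l)\bigr]}{\nu_k}=Q .$$ (2) If $\Omega$ is not too dense, then $$\limsup_{k\to\infty}\frac{\ln N(\nu_k)}{\nu_k}=\limsup_{k\to\infty}\frac{\ln\bigl[\sum_{l=1}^k N(\nu_l)\bigr]}{\nu_k}.$$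
   Context: A constrained system $A=(\mathcal{A},w)$ consists of a countable set $\mathcal{A}$ of strings and a weight function $w\colon\mathcal{A}\to\mathbb{R}_{>0}$ (positive real numbers) such that whenever $\mathtt{a},\mathtt{b}\in\mathcal{A}$ and the concatenation $\mathtt{a}\mathtt{b}\in\mathcal{A}$, then $w(\mathtt{a}\mathtt{b})=w(\mathtt{a})+w(\mathtt{b})$. $\Omega$ denotes the set of distinct values $w(a)$, $a\in\mathcal{A}$; it is assumed that it can be indexed as $\Omega=\{\nu_k\}_{k=1}^\infty$ with $\nu_1<\nu_2<\dotsb$. The numbers $N(\nu_k)$ are positive integers (in particular finite). The combinatorial capacity of $A$ is $\mathsf{C}=\limsup_{k\to\infty}\frac{\ln[\sum_{l=1}^k N(\nu_l)]}{\nu_k}$, with $\ln$ the natural logarithm. The abscissa of convergence $Q$ of $G_A$ (a general Dirichlet series in $s\in\mathbb{C}$) is the infimum, in the extended reals, of all $\sigma\in\mathbb{R}$ such that the series converges at $s=\sigma$; limits superior are also taken in the extended reals. $\Omega$ is called not too dense if there exist constants $L\ge 0$ and $K\ge 0$ such that for every integer $n\ge 0$, $\max_{\nu_k<n}k\le Ln^K$ (the maximum over the empty set being read as $0$). *)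

theory Defs
  imports "HOL-Analysis.Analysis"
begin

text \<open>Strings over an arbitrary alphabet are lists; the weight function is only relevant on the
  set of strings of the system.\<close>

definition constrained_system :: "'a list set \<Rightarrow> ('a list \<Rightarrow> real) \<Rightarrow> bool" where
  "constrained_system A w \<longleftrightarrow>
     countable A \<and> (\<forall>a\<in>A. w a > 0) \<and>
     (\<forall>a\<in>A. \<forall>b\<in>A. a @ b \<in> A \<longrightarrow> w (a @ b) = w a + w b)"

text \<open>Sequences of weights are indexed from 1; the value at index 0 is irrelevant.\<close>

definition enumerates_weights :: "'a list set \<Rightarrow> ('a list \<Rightarrow> real) \<Rightarrow> (nat \<Rightarrow> real) \<Rightarrow> bool" where
  "enumerates_weights A w \<nu> \<longleftrightarrow> strict_mono_on {1..} \<nu> \<and> \<nu> ` {1..} = w ` A"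

definition num_strings :: "'a list set \<Rightarrow> ('a list \<Rightarrow> real) \<Rightarrow> real \<Rightarrow> nat" where
  "num_strings A w x = card {a \<in> A. w a = x}"

definition combinatorial_capacity ::
    "'a list set \<Rightarrow> ('a list \<Rightarrow> real) \<Rightarrow> (nat \<Rightarrow> real) \<Rightarrow> ereal" where
  "combinatorial_capacity A w \<nu> =
     limsup (\<lambda>k. ereal (ln (real (\<Sum>l=1..k. num_strings A w (\<nu> l))) / \<nu> k))"

definition generating_function :: "'a list set \<Rightarrow> ('a list \<Rightarrow> real) \<Rightarrow> complex \<Rightarrow> complex" where
  "generating_function A w s = (\<Sum>\<^sub>\<infinity>a\<in>A. exp (- (complex_of_real (w a) * s)))"

definition dirichlet_term ::
    "'a list set \<Rightarrow> ('a list \<Rightarrow> real) \<Rightarrow> (nat \<Rightarrow> real) \<Rightarrow> complex \<Rightarrow> nat \<Rightarrow> complex" where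
  "dirichlet_term A w \<nu> s k =
     of_nat (num_strings A w (\<nu> k)) * exp (- (complex_of_real (\<nu> k) * s))"

definition abscissa_of_convergence ::
    "'a list set \<Rightarrow> ('a list \<Rightarrow> real) \<Rightarrow> (nat \<Rightarrow> real) \<Rightarrow> ereal" where
  "abscissa_of_convergence A w \<nu> =
     Inf (ereal ` {\<sigma>::real. summable (\<lambda>k. dirichlet_term A w \<nu> (complex_of_real \<sigma>) (Suc k))})"

text \<open>The finiteness conjunct is what makes the maximum meaningful; inserting 0 realises the
  convention that the maximum over the empty set is 0.  For \<open>n = 0\<close> and positive weights the
  index set is empty, so the value of \<open>0 powr 0\<close> plays no role.\<close>

definition not_too_dense :: "(nat \<Rightarrow> real) \<Rightarrow> bool" where
  "not_too_dense \<nu> \<longleftrightarrow>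
     (\<exists>L\<ge>0. \<exists>K\<ge>0. \<forall>n::nat. finite {k. 1 \<le> k \<and> \<nu> k < real n} \<and>
        real (Max (insert 0 {k. 1 \<le> k \<and> \<nu> k < real n})) \<le> L * real n powr K)"

text \<open>The next lemmas justify defining the abscissa of convergence by the Dirichlet series
  grouped by weight: it converges to the sum over all strings wherever the latter exists, and at
  real points both converge simultaneously.\<close>

lemma bij_betw_strings_by_weight:
  assumes "enumerates_weights A w \<nu>"
  shows "bij_betw snd (Sigma UNIV (\<lambda>k. {a \<in> A. w a = \<nu> (Suc k)})) A"
proof -
  have mono: "strict_mono_on {1..} \<nu>" and im: "\<nu> ` {1..} = w ` A"
    using assms by (auto simp: enumerates_weights_def)
  have inj: "inj_on \<nu> {1..}"
    using mono by (rule strict_mono_on_imp_inj_on)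
  have "inj_on snd (Sigma UNIV (\<lambda>k. {a \<in> A. w a = \<nu> (Suc k)}))"
    by (rule inj_onI) (use inj in \<open>auto dest: inj_onD\<close>)
  moreover have "snd ` Sigma UNIV (\<lambda>k. {a \<in> A. w a = \<nu> (Suc k)}) = A"
  proof (intro equalityI subsetI)
    fix a assume a: "a \<in> A"
    then have "w a \<in> \<nu> ` {1..}"
      unfolding im by (rule imageI)
    then obtain k where "k \<ge> 1" "w a = \<nu> k"
      by auto
    then have "(k - 1, a) \<in> Sigma UNIV (\<lambda>k. {a \<in> A. w a = \<nu> (Suc k)})"
      using a by simp
    then show "a \<in> snd ` Sigma UNIV (\<lambda>k. {a \<in> A. w a = \<nu> (Suc k)})"
      by (rule image_eqI[rotated]) simp
  qed auto
  ultimately show ?thesis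
    by (simp add: bij_betw_def)
qed

lemma dirichlet_series_sums_generating_function:
  assumes "enumerates_weights A w \<nu>"
    and fin: "\<And>k. k \<ge> 1 \<Longrightarrow> finite {a \<in> A. w a = \<nu> k}"
    and "(\<lambda>a. exp (- (complex_of_real (w a) * s))) summable_on A"
  shows "(\<lambda>k. dirichlet_term A w \<nu> s (Suc k)) sums generating_function A w s"
proof -
  let ?f = "\<lambda>a. exp (- (complex_of_real (w a) * s))"
  let ?B = "\<lambda>k. {a \<in> A. w a = \<nu> (Suc k)}"
  have "(?f has_sum generating_function A w s) A"
    using assms(3) by (simp add: generating_function_def)
  then have "((\<lambda>p. ?f (snd p)) has_sum generating_function A w s) (Sigma UNIV ?B)"
    using has_sum_reindex_bij_betw[OF bij_betw_strings_by_weight[OF assms(1)], of ?f] by simp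
  moreover have "((\<lambda>a. ?f (snd (k, a))) has_sum dirichlet_term A w \<nu> s (Suc k)) (?B k)" for k
    by (rule has_sum_finiteI) (use fin in \<open>auto simp: dirichlet_term_def num_strings_def\<close>)
  ultimately have "((\<lambda>k. dirichlet_term A w \<nu> s (Suc k)) has_sum generating_function A w s) UNIV"
    by (rule has_sum_SigmaD)
  then show ?thesis
    by (rule has_sum_imp_sums)
qed

lemma summable_dirichlet_series_iff:
  assumes "enumerates_weights A w \<nu>"
    and fin: "\<And>k. k \<ge> 1 \<Longrightarrow> finite {a \<in> A. w a = \<nu> k}"
  shows "summable (\<lambda>k. dirichlet_term A w \<nu> (complex_of_real \<sigma>) (Suc k)) \<longleftrightarrow>
         (\<lambda>a. exp (- (complex_of_real (w a) * complex_of_real \<sigma>))) summable_on A"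
    (is "?L \<longleftrightarrow> ?R")
proof
  assume ?R
  then show ?L
    using dirichlet_series_sums_generating_function[OF assms] by (blast intro: sums_summable)
next
  let ?f = "\<lambda>a. exp (- (w a * \<sigma>))"
  let ?B = "\<lambda>k. {a \<in> A. w a = \<nu> (Suc k)}"
  let ?g = "\<lambda>k. real (num_strings A w (\<nu> (Suc k))) * exp (- (\<nu> (Suc k) * \<sigma>))"
  assume ?L
  have "dirichlet_term A w \<nu> (complex_of_real \<sigma>) (Suc k) = complex_of_real (?g k)" for k
    by (simp only: dirichlet_term_def exp_of_real[symmetric] of_real_minus of_real_mult of_real_of_nat_eq)
  with \<open>?L\<close> have "summable ?g"
    by (simp only: summable_of_real_iff)
  then have "?g summable_on UNIV"
    by (subst summable_on_UNIV_nonneg_real_iff) auto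
  moreover have "((\<lambda>a. ?f (snd (k, a))) has_sum ?g k) (?B k)" for k
    by (rule has_sum_finiteI) (use fin in \<open>auto simp: num_strings_def\<close>)
  ultimately have "(\<lambda>p. ?f (snd p)) summable_on Sigma UNIV ?B"
    by (intro summable_on_SigmaI[where g = ?g]) auto
  then have "?f summable_on A"
    using summable_on_reindex_bij_betw[OF bij_betw_strings_by_weight[OF assms(1)], of ?f] by simp
  then have "(\<lambda>a. complex_of_real (?f a)) summable_on A"
    by (rule summable_on_of_real)
  moreover have "complex_of_real (?f a) = exp (- (complex_of_real (w a) * complex_of_real \<sigma>))" for a
    by (simp only: exp_of_real[symmetric] of_real_minus of_real_mult)
  ultimately show ?R
    by simp
qed

end

theory Submission
  imports Defs "HOL-Real_Asymp.Real_Asymp"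
begin

text \<open>Write \<open>S k\<close> for the number of strings of weight at most \<open>\<nu> k\<close>. If the Dirichlet series
  converges at \<open>\<sigma>\<close>, then \<open>\<sigma> > 0\<close> and \<open>S k * exp (- (\<nu> k * \<sigma>))\<close> is bounded by the sum of the series,
  so the capacity is at most \<open>\<sigma>\<close>. Conversely, if \<open>S k \<le> exp (\<tau> * \<nu> k)\<close> eventually and \<open>\<tau> < \<sigma>\<close>, then
  \<open>exp (- (\<nu> k * \<sigma>)) \<le> S k powr - (\<sigma> / \<tau>)\<close>, and the series at \<open>\<sigma>\<close> is dominated by
  \<open>\<Sum>m. m powr - (\<sigma> / \<tau>)\<close>, because the \<open>k\<close>-th term is at most the sum over
  \<open>S (k - 1) < m \<le> S k\<close>. For the second claim, \<open>S k\<close> is at most \<open>k\<close> times the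
  largest of the first \<open>k\<close> coefficients, and \<open>ln k\<close> is negligible compared with \<open>\<nu> k\<close>.\<close>

section \<open>Comparison with the series of powers of m\<close>

lemma sum_mult_powr_partial_sum_le:
  fixes a :: "nat \<Rightarrow> nat" and p :: real
  assumes "p \<ge> 0"
  shows "(\<Sum>k=1..n. real (a k) * real (\<Sum>l=1..k. a l) powr - p) \<le>
         (\<Sum>m=1..(\<Sum>l=1..n. a l). real m powr - p)"
proof (induction n)
  case 0
  then show ?case by simp
next
  case (Suc n)
  let ?S = "\<lambda>k. \<Sum>l=1..k. a l"
  \<comment> \<open>The block between consecutive partial sums has exactly \<open>a (Suc n)\<close>
    elements, and successive blocks tile the range of m.\<close>
  have "real (a (Suc n)) * real (?S (Suc n)) powr - p =
        (\<Sum>m\<in>{?S n<..?S (Suc n)}. real (?S (Suc n)) powr - p)"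
    by simp
  also have "\<dots> \<le> (\<Sum>m\<in>{?S n<..?S (Suc n)}. real m powr - p)"
    by (intro sum_mono powr_mono2')
      (use assms in \<open>auto simp del: of_nat_sum sum.cl_ivl_Suc\<close>)
  finally have "real (a (Suc n)) * real (?S (Suc n)) powr - p \<le>
    (\<Sum>m\<in>{?S n<..?S (Suc n)}. real m powr - p)" .
  moreover have "{1..?S (Suc n)} = {1..?S n} \<union> {?S n<..?S (Suc n)}"
    by auto
  then have "(\<Sum>m=1..?S (Suc n). real m powr - p) =
    (\<Sum>m=1..?S n. real m powr - p) + (\<Sum>m\<in>{?S n<..?S (Suc n)}. real m powr - p)"
    by (simp only:) (rule sum.union_disjoint, auto)
  ultimately show ?case
    using Suc.IH by simp
qed

lemma summable_mult_powr_partial_sum: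
  fixes a :: "nat \<Rightarrow> nat" and p :: real
  assumes "p > 1"
  shows "summable (\<lambda>k. real (a (Suc k)) * real (\<Sum>l=1..Suc k. a l) powr - p)"
proof (rule summableI_nonneg_bounded)
  fix n
  have sm: "summable (\<lambda>m. real m powr - p)"
    using assms by (simp add: summable_real_powr_iff)
  have "(\<Sum>k<n. real (a (Suc k)) * real (\<Sum>l=1..Suc k. a l) powr - p) =
        (\<Sum>k=1..n. real (a k) * real (\<Sum>l=1..k. a l) powr - p)"
    by (rule sum.reindex_bij_witness[of _ "\<lambda>k. k - 1" Suc]) auto
  also have "\<dots> \<le> (\<Sum>m=1..(\<Sum>l=1..n. a l). real m powr - p)"
    using assms by (intro sum_mult_powr_partial_sum_le) simp
  also have "\<dots> \<le> (\<Sum>m. real m powr - p)"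
    by (rule sum_le_suminf[OF sm]) auto
  finally show "(\<Sum>k<n. real (a (Suc k)) * real (\<Sum>l=1..Suc k. a l) powr - p) \<le>
    (\<Sum>m. real m powr - p)" .
qed simp

section \<open>Dirichlet series with positive integer coefficients\<close>

text \<open>Divergence of the exponents is not assumed: it is derived from convergence at some real
  point, or from \<open>not_too_dense\<close>.\<close>

locale positive_dirichlet_series =
  fixes a :: "nat \<Rightarrow> nat" and \<nu> :: "nat \<Rightarrow> real"
  assumes coeff_pos: "k \<ge> 1 \<Longrightarrow> a k > 0"
    and exponent_pos: "k \<ge> 1 \<Longrightarrow> \<nu> k > 0"
    and exponent_mono: "1 \<le> j \<Longrightarrow> j \<le> k \<Longrightarrow> \<nu> j \<le> \<nu> k"
begin

definition S :: "nat \<Rightarrow> nat" where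
  "S k = (\<Sum>l=1..k. a l)"

lemma coeff_le_S: "k \<ge> 1 \<Longrightarrow> a k \<le> S k"
  unfolding S_def by (rule member_le_sum) auto

lemma S_pos: "k \<ge> 1 \<Longrightarrow> S k > 0"
  using coeff_le_S coeff_pos by (meson less_le_trans)

text \<open>Coefficients are at least 1, so convergence forces the bare exponentials to 0. Hence
  \<nu> k * \<sigma> tends to infinity, and positive exponents leave only \<sigma> > 0.\<close>

lemma summable_imp_exponent_at_top:
  assumes "summable (\<lambda>k. real (a (Suc k)) * exp (- (\<nu> (Suc k) * \<sigma>)))"
  shows "\<sigma> > 0" and "filterlim \<nu> at_top sequentially"
proof -
  let ?e = "\<lambda>k. exp (- (\<nu> (Suc k) * \<sigma>))"
  have "(\<lambda>k. real (a (Suc k)) * ?e k) \<longlonglongrightarrow> 0"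
    using assms by (rule summable_LIMSEQ_zero)
  moreover have "?e k \<le> real (a (Suc k)) * ?e k" for k
    using coeff_pos[of "Suc k"] by simp
  ultimately have "?e \<longlonglongrightarrow> 0"
    by (intro tendsto_sandwich[of "\<lambda>_. 0" ?e sequentially "\<lambda>k. real (a (Suc k)) * ?e k"]) auto
  \<comment> \<open>Positivity of the exponentials makes this an approach to 0 from the right, where
    \<open>ln\<close> diverges.\<close>
  then have "filterlim (\<lambda>k. ln (?e k)) at_bot sequentially"
    by (intro filterlim_compose[OF ln_at_0])
       (auto simp: filterlim_at)
  then have lim: "filterlim (\<lambda>k. \<nu> (Suc k) * \<sigma>) at_top sequentially"
    by (simp add: filterlim_uminus_at_top)
  then have "eventually (\<lambda>k. \<nu> (Suc k) * \<sigma> > 0) sequentially"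
    by (simp add: filterlim_at_top_dense)
  then obtain k where "\<nu> (Suc k) * \<sigma> > 0"
    using eventually_happens by fastforce
  then show pos: "\<sigma> > 0"
    using exponent_pos[of "Suc k"] by (simp add: zero_less_mult_iff)
  have "filterlim (\<lambda>k. inverse \<sigma> * (\<nu> (Suc k) * \<sigma>)) at_top sequentially"
    by (rule filterlim_tendsto_pos_mult_at_top[OF tendsto_const _ lim]) (use pos in simp)
  then have "filterlim (\<lambda>k. \<nu> (Suc k)) at_top sequentially"
    using pos by (simp add: field_simps)
  then show "filterlim \<nu> at_top sequentially"
    by (simp add: filterlim_sequentially_Suc)
qed

section \<open>Growth of partial sums and the abscissa\<close>

lemma limsup_ln_S_le_if_summable:
  assumes sm: "summable (\<lambda>k. real (a (Suc k)) * exp (- (\<nu> (Suc k) * \<sigma>)))"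
  shows "limsup (\<lambda>k. ereal (ln (real (S k)) / \<nu> k)) \<le> ereal \<sigma>"
proof -
  have \<sigma>: "\<sigma> > 0" and top: "filterlim \<nu> at_top sequentially"
    using summable_imp_exponent_at_top[OF sm] by auto
  define G where "G = (\<Sum>k. real (a (Suc k)) * exp (- (\<nu> (Suc k) * \<sigma>)))"
  have bound: "real (S k) * exp (- (\<nu> k * \<sigma>)) \<le> G" if "k \<ge> 1" for k
  proof -
    have "real (S k) * exp (- (\<nu> k * \<sigma>)) = (\<Sum>l=1..k. real (a l) * exp (- (\<nu> k * \<sigma>)))"
      by (simp add: S_def sum_distrib_right)
    \<comment> \<open>As \<sigma> > 0, lowering the exponent from \<nu> k to \<nu> l enlarges each
      factor.\<close>
    also have "\<dots> \<le> (\<Sum>l=1..k. real (a l) * exp (- (\<nu> l * \<sigma>)))"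
      by (intro sum_mono mult_left_mono) (use \<sigma> exponent_mono in auto)
    also have "\<dots> = (\<Sum>l<k. real (a (Suc l)) * exp (- (\<nu> (Suc l) * \<sigma>)))"
      by (rule sum.reindex_bij_witness[of _ Suc "\<lambda>k. k - 1"]) auto
    also have "\<dots> \<le> G"
      unfolding G_def by (rule sum_le_suminf[OF sm]) auto
    finally show ?thesis .
  qed
  have "ln (real (S k)) / \<nu> k \<le> ln G / \<nu> k + \<sigma>" if k: "k \<ge> 1" for k
  proof -
    have "ln (real (S k) * exp (- (\<nu> k * \<sigma>))) \<le> ln G"
      using bound[OF k] S_pos[OF k] by (intro ln_mono) auto
    then have "ln (real (S k)) \<le> ln G + \<nu> k * \<sigma>"
      using S_pos[OF k] by (simp add: ln_mult)
    then show ?thesis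
      using exponent_pos[OF k] by (simp add: field_simps)
  qed
  then have "limsup (\<lambda>k. ereal (ln (real (S k)) / \<nu> k)) \<le> limsup (\<lambda>k. ereal (ln G / \<nu> k + \<sigma>))"
    by (intro Limsup_mono) (auto intro: eventually_sequentiallyI[of 1])
  also have "(\<lambda>k. ln G / \<nu> k + \<sigma>) \<longlonglongrightarrow> 0 + \<sigma>"
    by (intro tendsto_intros tendsto_divide_0[OF tendsto_const] filterlim_at_top_imp_at_infinity top)
  then have "limsup (\<lambda>k. ereal (ln G / \<nu> k + \<sigma>)) = ereal \<sigma>"
    by (intro lim_imp_Limsup) auto
  finally show ?thesis .
qed

text \<open>Ensures that a real \<tau> strictly above such a limit superior is positive; applied to
  both \<open>S\<close> and \<open>a\<close>.\<close>

lemma limsup_ln_div_exponent_nonneg: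
  assumes "\<And>k. k \<ge> 1 \<Longrightarrow> b k \<ge> (1 :: nat)"
  shows "limsup (\<lambda>k. ereal (ln (real (b k)) / \<nu> k)) \<ge> 0"
proof -
  have "0 \<le> ereal (ln (real (b k)) / \<nu> k)" if "k \<ge> 1" for k
    using assms[OF that] exponent_pos[OF that] by simp
  then have "limsup (\<lambda>k. 0) \<le> limsup (\<lambda>k. ereal (ln (real (b k)) / \<nu> k))"
    by (intro Limsup_mono) (rule eventually_sequentiallyI)
  then show ?thesis by (simp add: Limsup_const)
qed

lemma eventually_le_exp_if_limsup_less:
  assumes "limsup (\<lambda>k. ereal (ln (real (b k)) / \<nu> k)) < ereal \<tau>"
    and "\<And>k. k \<ge> 1 \<Longrightarrow> b k \<ge> (1 :: nat)"
  shows "eventually (\<lambda>k. real (b k) \<le> exp (\<tau> * \<nu> k)) sequentially"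
  using Limsup_lessD[OF assms(1)] eventually_ge_at_top[of 1]
proof eventually_elim
  case (elim k)
  then have "ln (real (b k)) \<le> \<tau> * \<nu> k"
    using exponent_pos[of k] by (simp add: pos_divide_less_eq)
  then have "exp (ln (real (b k))) \<le> exp (\<tau> * \<nu> k)"
    by (simp only: exp_le_cancel_iff)
  also have "exp (ln (real (b k))) = real (b k)"
    using assms(2)[of k] elim by (intro exp_ln) auto
  finally show ?case .
qed

lemma summable_if_limsup_ln_S_less:
  assumes "limsup (\<lambda>k. ereal (ln (real (S k)) / \<nu> k)) < ereal \<sigma>"
  shows "summable (\<lambda>k. real (a (Suc k)) * exp (- (\<nu> (Suc k) * \<sigma>)))"
proof -
  have S1: "S k \<ge> 1" if "k \<ge> 1" for k
    using S_pos[OF that] by simp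
  \<comment> \<open>The gap between \<tau> and \<sigma> is what makes the power p = \<sigma> /
    \<tau> exceed 1.\<close>
  obtain \<tau> where \<tau>: "limsup (\<lambda>k. ereal (ln (real (S k)) / \<nu> k)) < ereal \<tau>" "\<tau> < \<sigma>"
    using ereal_dense2[OF assms] by auto
  have "0 < ereal \<tau>"
    using limsup_ln_div_exponent_nonneg[of S] S1 \<tau>(1) by (meson le_less_trans)
  then have "\<tau> > 0" by simp
  define p where "p = \<sigma> / \<tau>"
  have p: "p > 1"
    using \<tau> \<open>\<tau> > 0\<close> by (simp add: p_def)
  have "eventually (\<lambda>k. real (S (Suc k)) \<le> exp (\<tau> * \<nu> (Suc k))) sequentially"
    using eventually_le_exp_if_limsup_less[OF \<tau>(1) S1]
    by (subst eventually_sequentially_Suc)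
  then have "eventually (\<lambda>k. norm (real (a (Suc k)) * exp (- (\<nu> (Suc k) * \<sigma>))) \<le>
    real (a (Suc k)) * real (S (Suc k)) powr - p) sequentially"
  proof eventually_elim
    case (elim k)
    \<comment> \<open>The negative power reverses the growth bound on \<open>S\<close>, and p is
      chosen to turn \<tau> into \<sigma> in the exponent.\<close>
    have "exp (\<tau> * \<nu> (Suc k)) powr - p \<le> real (S (Suc k)) powr - p"
      by (rule powr_mono2') (use elim p S_pos[of "Suc k"] in auto)
    also have "exp (\<tau> * \<nu> (Suc k)) powr - p = exp (- (\<nu> (Suc k) * \<sigma>))"
      using \<open>\<tau> > 0\<close> by (simp add: powr_def p_def)
    finally show ?case
      by (simp add: mult_left_mono)
  qed
  then show ?thesis
    by (rule summable_comparison_test_ev)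
       (use summable_mult_powr_partial_sum[OF p, of a] in \<open>simp only: S_def\<close>)
qed

text \<open>Any real strictly above the limit superior is a point of convergence. Since the reals
  are dense in the extended reals, infinite values, such as the infimum of the empty set, need no
  separate case.\<close>

lemma limsup_ln_S_eq_abscissa:
  "limsup (\<lambda>k. ereal (ln (real (S k)) / \<nu> k)) =
   Inf (ereal ` {\<sigma>. summable (\<lambda>k. real (a (Suc k)) * exp (- (\<nu> (Suc k) * \<sigma>)))})"
  (is "?C = ?Q")
proof (rule antisym)
  show "?C \<le> ?Q"
    by (rule Inf_greatest) (auto intro: limsup_ln_S_le_if_summable)
  show "?Q \<le> ?C"
  proof (rule ccontr)
    assume "\<not> ?Q \<le> ?C"
    then obtain \<sigma> where \<sigma>: "?C < ereal \<sigma>" "ereal \<sigma> < ?Q"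
      using ereal_dense2[of ?C ?Q] by (auto simp: not_le)
    then have "?Q \<le> ereal \<sigma>"
      by (intro Inf_lower imageI CollectI summable_if_limsup_ln_S_less)
    with \<sigma> show False by simp
  qed
qed

section \<open>Exponents that are not too dense\<close>

lemma not_too_dense_imp_exponent_at_top:
  assumes "not_too_dense \<nu>"
  shows "filterlim \<nu> at_top sequentially"
  unfolding filterlim_at_top
proof
  fix Z :: real
  obtain n :: nat where n: "Z \<le> real n"
    using real_arch_simple by blast
  have "finite {k. 1 \<le> k \<and> \<nu> k < real n}"
    using assms by (auto simp: not_too_dense_def)
  then have "eventually (\<lambda>k. k \<notin> {k. 1 \<le> k \<and> \<nu> k < real n}) sequentially"
    by (simp add: cofinite_eq_sequentially[symmetric] eventually_cofinite)
  then show "eventually (\<lambda>k. Z \<le> \<nu> k) sequentially"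
    using eventually_ge_at_top[of 1] by eventually_elim (use n in auto)
qed

text \<open>The density condition bounds k by a polynomial in \<nu> k, so ln k grows at most
  logarithmically in \<nu> k.\<close>

lemma not_too_dense_imp_ln_index_negligible:
  assumes "not_too_dense \<nu>"
  shows "(\<lambda>k. ln (real k) / \<nu> k) \<longlonglongrightarrow> 0"
proof -
  obtain L K where LK: "L \<ge> 0" "K \<ge> 0"
    and fin: "\<And>n::nat. finite {k. 1 \<le> k \<and> \<nu> k < real n}"
    and le: "\<And>n::nat. real (Max (insert 0 {k. 1 \<le> k \<and> \<nu> k < real n})) \<le> L * real n powr K"
    using assms by (auto simp: not_too_dense_def)
  have upper: "ln (real k) \<le> ln (L + 1) + K * ln (\<nu> k + 1)" if k: "k \<ge> 1" for k
  proof -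
    have pos: "\<nu> k > 0" using exponent_pos[OF k] .
    \<comment> \<open>The least integer strictly above \<nu> k, so that k itself belongs to the set
      whose maximum is bounded.\<close>
    define n where "n = Suc (nat \<lfloor>\<nu> k\<rfloor>)"
    have n: "\<nu> k < real n" "real n \<le> \<nu> k + 1"
      using pos by (simp_all add: n_def) linarith+
    have "k \<le> Max (insert 0 {k. 1 \<le> k \<and> \<nu> k < real n})"
      by (rule Max_ge) (use fin[of n] n k in auto)
    then have "real k \<le> L * real n powr K"
      using le[of n] by linarith
    \<comment> \<open>Passing to L + 1 keeps the logarithm of the constant meaningful when L =
      0.\<close>
    also have "\<dots> \<le> (L + 1) * (\<nu> k + 1) powr K"
      by (intro mult_mono powr_mono2) (use LK n pos in auto)
    finally have "ln (real k) \<le> ln ((L + 1) * (\<nu> k + 1) powr K)"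
      using k by (intro ln_mono) auto
    then show ?thesis
      using LK pos by (simp add: ln_mult ln_powr)
  qed
  have "((\<lambda>x. (ln (L + 1) + K * ln (x + 1)) / x) \<longlongrightarrow> 0) at_top"
    by real_asymp
  then have lim: "(\<lambda>k. (ln (L + 1) + K * ln (\<nu> k + 1)) / \<nu> k) \<longlonglongrightarrow> 0"
    using not_too_dense_imp_exponent_at_top[OF assms] by (rule filterlim_compose)
  have "0 \<le> ln (real k) / \<nu> k" if "k \<ge> 1" for k
    using exponent_pos[OF that] that by simp
  moreover have "ln (real k) / \<nu> k \<le> (ln (L + 1) + K * ln (\<nu> k + 1)) / \<nu> k" if "k \<ge> 1" for k
    using upper[OF that] exponent_pos[OF that] by (intro divide_right_mono) auto
  ultimately show ?thesis
    by (intro tendsto_sandwich[OF _ _ tendsto_const lim] eventually_sequentiallyI[of 1])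
qed

text \<open>If the coefficients grow at most like exp (\<tau> * \<nu> k), then \<open>S\<close>
  gains only a factor k times a constant, which vanishes after taking logarithms and dividing by
  \<nu> k.\<close>

lemma limsup_ln_coeff_eq_limsup_ln_S:
  assumes "not_too_dense \<nu>"
  shows "limsup (\<lambda>k. ereal (ln (real (a k)) / \<nu> k)) =
         limsup (\<lambda>k. ereal (ln (real (S k)) / \<nu> k))"
    (is "?D = ?C")
proof (rule antisym)
  have "ln (real (a k)) / \<nu> k \<le> ln (real (S k)) / \<nu> k" if "k \<ge> 1" for k
    using coeff_le_S[OF that] coeff_pos[OF that] exponent_pos[OF that]
    by (intro divide_right_mono ln_mono) auto
  then show "?D \<le> ?C"
    by (intro Limsup_mono) (auto intro: eventually_sequentiallyI[of 1])
  have a1: "a k \<ge> 1" if "k \<ge> 1" for k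
    using coeff_pos[OF that] by simp
  show "?C \<le> ?D"
  proof (rule ccontr)
    assume "\<not> ?C \<le> ?D"
    then obtain \<tau> where \<tau>: "?D < ereal \<tau>" "ereal \<tau> < ?C"
      using ereal_dense2[of ?D ?C] by (auto simp: not_le)
    have "0 < ereal \<tau>"
      using limsup_ln_div_exponent_nonneg[of a] a1 \<tau>(1) by (meson le_less_trans)
    then have "\<tau> > 0" by simp
    obtain m where m: "\<And>k. k \<ge> m \<Longrightarrow> real (a k) \<le> exp (\<tau> * \<nu> k)"
      using eventually_le_exp_if_limsup_less[OF \<tau>(1) a1]
      unfolding eventually_sequentially by auto
    \<comment> \<open>The sum absorbs the finitely many coefficients before the bound sets in; the
      added 1 preserves the bound from m on.\<close>
    define M where "M = 1 + real (\<Sum>l<m. a l)"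
    have "M \<ge> 1" by (simp add: M_def del: of_nat_sum)
    have coeff: "real (a l) \<le> M * exp (\<tau> * \<nu> l)" if "l \<ge> 1" for l
    proof (cases "l < m")
      case True
      then have "real (a l) \<le> real (\<Sum>l<m. a l)"
        unfolding of_nat_le_iff by (intro member_le_sum) auto
      then have "real (a l) \<le> M * 1"
        unfolding M_def mult_1_right by linarith
      also have "\<dots> \<le> M * exp (\<tau> * \<nu> l)"
        by (intro mult_left_mono) (use \<open>M \<ge> 1\<close> \<open>\<tau> > 0\<close> exponent_pos[OF that] in auto)
      finally show ?thesis .
    next
      case False
      then have "real (a l) \<le> 1 * exp (\<tau> * \<nu> l)" using m by simp
      also have "\<dots> \<le> M * exp (\<tau> * \<nu> l)"
        using \<open>M \<ge> 1\<close> by (intro mult_right_mono) auto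
      finally show ?thesis .
    qed
    have "ln (real (S k)) / \<nu> k \<le> ln (real k) / \<nu> k + ln M / \<nu> k + \<tau>" if k: "k \<ge> 1" for k
    proof -
      \<comment> \<open>Since \<tau> > 0, the bound at the last exponent dominates the bounds at all
        earlier ones.\<close>
      have "real (S k) \<le> (\<Sum>l=1..k. M * exp (\<tau> * \<nu> k))"
        unfolding S_def of_nat_sum
      proof (rule sum_mono)
        fix l assume l: "l \<in> {1..k}"
        then have "real (a l) \<le> M * exp (\<tau> * \<nu> l)" using coeff by simp
        also have "\<dots> \<le> M * exp (\<tau> * \<nu> k)"
          using l exponent_mono[of l k] \<open>M \<ge> 1\<close> \<open>\<tau> > 0\<close> by simp
        finally show "real (a l) \<le> M * exp (\<tau> * \<nu> k)" .
      qed
      then have "ln (real (S k)) \<le> ln (real k * (M * exp (\<tau> * \<nu> k)))"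
        using S_pos[OF k] by (intro ln_mono) auto
      also have "\<dots> = ln (real k) + ln M + \<tau> * \<nu> k"
        using k \<open>M \<ge> 1\<close> by (simp add: ln_mult)
      finally show ?thesis
        using exponent_pos[OF k] by (simp add: field_simps)
    qed
    then have "?C \<le> limsup (\<lambda>k. ereal (ln (real k) / \<nu> k + ln M / \<nu> k + \<tau>))"
      by (intro Limsup_mono) (auto intro: eventually_sequentiallyI[of 1])
    also have "(\<lambda>k. ln (real k) / \<nu> k + ln M / \<nu> k + \<tau>) \<longlonglongrightarrow> 0 + 0 + \<tau>"
      by (intro tendsto_intros not_too_dense_imp_ln_index_negligible assms
          tendsto_divide_0[OF tendsto_const] filterlim_at_top_imp_at_infinity
          not_too_dense_imp_exponent_at_top)
    then have "limsup (\<lambda>k. ereal (ln (real k) / \<nu> k + ln M / \<nu> k + \<tau>)) = ereal \<tau>"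
      by (intro lim_imp_Limsup) auto
    finally show False
      using \<tau>(2) by simp
  qed
qed

end

section \<open>Application to constrained systems\<close>

lemma summable_dirichlet_term_real_iff:
  "summable (\<lambda>k. dirichlet_term A w \<nu> (complex_of_real \<sigma>) (Suc k)) \<longleftrightarrow>
   summable (\<lambda>k. real (num_strings A w (\<nu> (Suc k))) * exp (- (\<nu> (Suc k) * \<sigma>)))"
proof -
  have "dirichlet_term A w \<nu> (complex_of_real \<sigma>) (Suc k) =
    complex_of_real (real (num_strings A w (\<nu> (Suc k))) * exp (- (\<nu> (Suc k) * \<sigma>)))" for k
    by (simp only: dirichlet_term_def exp_of_real[symmetric] of_real_minus of_real_mult
        of_real_of_nat_eq)
  then show ?thesis
    by (simp only: summable_of_real_iff)
qed

theorem theorem1: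
  fixes A :: "'a list set" and w :: "'a list \<Rightarrow> real" and \<nu> :: "nat \<Rightarrow> real"
  assumes "constrained_system A w"
    and "enumerates_weights A w \<nu>"
    and "\<And>k. k \<ge> 1 \<Longrightarrow> finite {a \<in> A. w a = \<nu> k}"
  shows "combinatorial_capacity A w \<nu> = abscissa_of_convergence A w \<nu> \<and>
    (not_too_dense \<nu> \<longrightarrow>
       limsup (\<lambda>k. ereal (ln (real (num_strings A w (\<nu> k))) / \<nu> k)) =
       limsup (\<lambda>k. ereal (ln (real (\<Sum>l=1..k. num_strings A w (\<nu> l))) / \<nu> k)))"
proof -
  have mono: "strict_mono_on {1..} \<nu>" and im: "\<nu> ` {1..} = w ` A"
    using assms(2) by (auto simp: enumerates_weights_def)
  have attained: "\<exists>x\<in>A. w x = \<nu> k" if "k \<ge> 1" for k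
  proof -
    have "\<nu> k \<in> w ` A"
      using that im[symmetric] by simp
    then show ?thesis by auto
  qed
  interpret positive_dirichlet_series "\<lambda>k. num_strings A w (\<nu> k)" \<nu>
  proof
    fix k :: nat assume k: "k \<ge> 1"
    \<comment> \<open>\<open>card\<close> is 0 on infinite sets as well as on the empty one, so
      finiteness and an attained weight both enter.\<close>
    show "num_strings A w (\<nu> k) > 0"
      using attained[OF k] assms(3)[OF k] by (auto simp: num_strings_def card_gt_0_iff)
    show "\<nu> k > 0"
      using attained[OF k] assms(1) by (auto simp: constrained_system_def)
  next
    fix j k :: nat assume "1 \<le> j" "j \<le> k"
    then show "\<nu> j \<le> \<nu> k"
      using strict_mono_onD[OF mono, of j k] by (cases "j = k") auto
  qed
  show ?thesis
    using limsup_ln_S_eq_abscissa limsup_ln_coeff_eq_limsup_ln_S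
    unfolding combinatorial_capacity_def abscissa_of_convergence_def
      summable_dirichlet_term_real_iff S_def by simp
qed

end
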